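(* Consider the planar two-dumbbell problem with nontrivial dumbbells and the perpendicular configuration $(\theta_1,\theta_2)=(\tfrac{\pi}{2},0)$. In this configuration there is exactly one family of relative equilibria: the isosceles family, consisting of the configurations with $d_{11}=d_{21}$ and $d_{12}=d_{22}$, in which the two masses on the vertical body (dumbbell 1) are equal, $x_{11}=x_{12}$.
   Context: Planar two-dumbbell problem: two dumbbells with total masses $M_1,M_2>0$, $M_1+M_2=1$, move in a plane under Newtonian gravity ($G=1$). Dumbbell $i$ consists of two point masses $M_ix_{i1}$, $M_ix_{i2}$ ($x_{i1}+x_{i2}=1$) joined by a massless rod of length $\ell_i$, with $\ell_1+\ell_2=1$. Nontrivial means $x_{ij}\in(0,1)$, $\ell_i>0$ and $r>0$. Let $\vec r$ be the vector from the center of mass of dumbbell 1 to that of dumbbell 2, $r=|\vec r|$, and $\theta_i$ the angle between $\vec r$ and the rod of dumbbell $i$. In a frame with first axis along $\vec r$ and origin at the system's center of mass, mass $j$ of dumbbell $i$ is at $$\vec r_{ij}=(-1)^iM_nr(1,0)+(-1)^jx_{ik}\ell_i(\cos\theta_i,\sin\theta_i),\qquad n\ne i,\ k\ne j,$$ with all indices in $\{1,2\}$. Let $d_{uv}=|\vec r_{1u}-\vec r_{2v}|$ and $B_1=\frac{x_{11}x_{12}}{M_2}\ell_1^2$, $B_2=\frac{x_{21}x_{22}}{M_1}\ell_2^2$. The (scaled) amended potential for scalar angular momentum $L$ is $$V(r,\theta_1,\theta_2)=\frac{L^2}{2(r^2+B_1+B_2)}-\sum_{u,v\in\{1,2\}}\frac{x_{1u}x_{2v}}{d_{uv}}.$$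 A relative equilibrium (RE) is a critical point $(r,\theta_1,\theta_2)$, $r>0$, of $V$. The angular conditions $\partial_{\theta_1}V=\partial_{\theta_2}V=0$ do not involve $L$; the radial condition $\partial_rV=0$ then determines the real number $L^2$. In classifying RE, $L^2$ is treated as a real parameter determined in this way (an RE whose $L^2$ is negative is still called an RE, but is physically unrealizable). *)

theory Defs
  imports "HOL-Analysis.Analysis"
begin

text \<open>Indices range over {1, 2}, so the index different from \<open>i\<close> is \<open>3 - i\<close>. The total mass of
  dumbbell \<open>i\<close> is \<open>mass p i\<close>, its point masses are \<open>mass p i * mass_fraction p i j\<close>, and the length of its
  rod is \<open>rod p i\<close>. Values at other indices are never used.\<close>

record two_dumbbells =
  mass :: "nat \<Rightarrow> real"
  mass_fraction :: "nat \<Rightarrow> nat \<Rightarrow> real"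
  rod :: "nat \<Rightarrow> real"

definition nontrivial :: "two_dumbbells \<Rightarrow> bool" where
  "nontrivial p \<longleftrightarrow>
     (\<forall>i\<in>{1, 2}. mass p i > 0) \<and> mass p 1 + mass p 2 = 1 \<and>
     (\<forall>i\<in>{1, 2}. \<forall>j\<in>{1, 2}. mass_fraction p i j \<in> {0<..<1}) \<and>
     (\<forall>i\<in>{1, 2}. mass_fraction p i 1 + mass_fraction p i 2 = 1) \<and>
     (\<forall>i\<in>{1, 2}. rod p i > 0) \<and> rod p 1 + rod p 2 = 1"

text \<open>In the frame with first axis along the line of the centers of mass, this is the position of
  mass \<open>j\<close> of dumbbell \<open>i\<close>, where \<open>\<theta>\<close> is the angle of that dumbbell.\<close>

definition position :: "two_dumbbells \<Rightarrow> nat \<Rightarrow> nat \<Rightarrow> real \<Rightarrow> real \<Rightarrow> real \<times> real" where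
  "position p i j r \<theta> =
     ((-1) ^ i * mass p (3 - i) * r) *\<^sub>R (1, 0) +
     ((-1) ^ j * mass_fraction p i (3 - j) * rod p i) *\<^sub>R (cos \<theta>, sin \<theta>)"

definition mass_dist :: "two_dumbbells \<Rightarrow> nat \<Rightarrow> nat \<Rightarrow> real \<times> real \<times> real \<Rightarrow> real" where
  "mass_dist p u v = (\<lambda>(r, \<theta>\<^sub>1, \<theta>\<^sub>2). norm (position p 1 u r \<theta>\<^sub>1 - position p 2 v r \<theta>\<^sub>2))"

definition inertia :: "two_dumbbells \<Rightarrow> nat \<Rightarrow> real" where
  "inertia p i = mass_fraction p i 1 * mass_fraction p i 2 / mass p (3 - i) * (rod p i)\<^sup>2"

text \<open>The parameter \<open>L2\<close> stands for the squared angular momentum; it is an arbitrary real number and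
  may be negative.\<close>

definition amended_potential :: "two_dumbbells \<Rightarrow> real \<Rightarrow> real \<times> real \<times> real \<Rightarrow> real" where
  "amended_potential p L2 = (\<lambda>(r, \<theta>\<^sub>1, \<theta>\<^sub>2).
     L2 / (2 * (r\<^sup>2 + inertia p 1 + inertia p 2)) -
     (\<Sum>u\<in>{1, 2}. \<Sum>v\<in>{1, 2}. mass_fraction p 1 u * mass_fraction p 2 v / mass_dist p u v (r, \<theta>\<^sub>1, \<theta>\<^sub>2)))"

text \<open>At a collision the potential of a nontrivial system is unbounded nearby, hence not
  differentiable, so collision configurations are not relative equilibria in spite of \<open>x / 0 = 0\<close>.\<close>

definition relative_equilibrium :: "two_dumbbells \<Rightarrow> real \<Rightarrow> real \<times> real \<times> real \<Rightarrow> bool" where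
  "relative_equilibrium p L2 q \<longleftrightarrow>
     fst q > 0 \<and> (amended_potential p L2 has_derivative (\<lambda>_. 0)) (at q)"

definition perpendicular_equilibria :: "(two_dumbbells \<times> real) set" where
  "perpendicular_equilibria =
     {(p, r). nontrivial p \<and> (\<exists>L2. relative_equilibrium p L2 (r, pi / 2, 0))}"

definition isosceles_family :: "(two_dumbbells \<times> real) set" where
  "isosceles_family =
     {(p, r). nontrivial p \<and> r > 0 \<and>
        mass_dist p 1 1 (r, pi / 2, 0) = mass_dist p 2 1 (r, pi / 2, 0) \<and>
        mass_dist p 1 2 (r, pi / 2, 0) = mass_dist p 2 2 (r, pi / 2, 0)}"

end

theory Submission
  imports Defs
begin

text \<open>Write \<open>s\<^sub>u\<close>, \<open>t\<^sub>v\<close> for the signed positions of the masses on the two rods and put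
  \<open>D\<^sub>v = 1/d\<^sub>1\<^sub>v\<^sup>3 - 1/d\<^sub>2\<^sub>v\<^sup>3\<close>. Since \<open>x\<^sub>1\<^sub>u s\<^sub>u\<close> and \<open>x\<^sub>2\<^sub>v t\<^sub>v\<close> depend on the index only
  through their sign, at \<open>(\<pi>/2, 0)\<close> the second angular condition reads \<open>D\<^sub>1 = D\<^sub>2\<close> and the first one
  \<open>\<Sum>\<^sub>v x\<^sub>2\<^sub>v (r + t\<^sub>v) D\<^sub>v = 0\<close>. As \<open>\<Sum>\<^sub>v x\<^sub>2\<^sub>v t\<^sub>v = 0\<close>, together they give \<open>r D\<^sub>1 = 0\<close>, so both \<open>D\<^sub>v\<close>
  vanish. No two masses collide in this configuration, and the radial condition
  is linear in \<open>L\<^sup>2\<close> with nonzero coefficient, so it can always be solved.\<close>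

definition rod_offset :: "two_dumbbells \<Rightarrow> nat \<Rightarrow> nat \<Rightarrow> real" where
  "rod_offset p i j = (-1) ^ j * mass_fraction p i (3 - j) * rod p i"

lemma rod_offset_1: "rod_offset p i 1 = - mass_fraction p i 2 * rod p i"
  and rod_offset_2: "rod_offset p i 2 = mass_fraction p i 1 * rod p i"
  by (simp_all add: rod_offset_def numeral_2_eq_2)

text \<open>The centers of mass lie at -M_2 r and M_1 r on the first axis. As M_1 + M_2 = 1, they
  are exactly r apart, so the total masses drop out of the distance.\<close>

lemma mass_dist_eq:
  assumes "nontrivial p"
  shows "mass_dist p u v (r, a, b) =
    sqrt ((rod_offset p 1 u * cos a - rod_offset p 2 v * cos b - r)\<^sup>2 +
      (rod_offset p 1 u * sin a - rod_offset p 2 v * sin b)\<^sup>2)"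
proof -
  have m: "mass p (Suc 0) = 1 - mass p 2"
    using assms by (simp add: nontrivial_def)
  show ?thesis
    by (simp add: mass_dist_def position_def rod_offset_def norm_Pair m algebra_simps)
qed

lemma mass_dist_perpendicular:
  assumes "nontrivial p"
  shows "mass_dist p u v (r, pi / 2, 0) = sqrt ((r + rod_offset p 2 v)\<^sup>2 + (rod_offset p 1 u)\<^sup>2)"
  by (simp add: mass_dist_eq[OF assms] power2_eq_square algebra_simps)

text \<open>Rod 2 lies on the first axis, while both masses of the perpendicular rod 1 are off
  it.\<close>

lemma mass_dist_perpendicular_pos:
  assumes "nontrivial p" "u \<in> {1, 2}"
  shows "mass_dist p u v (r, pi / 2, 0) > 0"
proof -
  have "rod_offset p 1 u \<noteq> 0"
    using assms by (auto simp: nontrivial_def rod_offset_1 [simplified] rod_offset_2)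
  then show ?thesis
    by (simp add: mass_dist_perpendicular[OF assms(1)] sum_power2_gt_zero_iff)
qed

text \<open>Both masses of dumbbell 1 have the same first coordinate, so only their heights over the
  axis are compared. The resulting condition is the same for both \<open>v\<close>.\<close>

lemma mass_dist_perpendicular_eq_iff:
  assumes "nontrivial p"
  shows "mass_dist p 1 v (r, pi / 2, 0) = mass_dist p 2 v (r, pi / 2, 0) \<longleftrightarrow>
    mass_fraction p 1 1 = mass_fraction p 1 2"
proof -
  have "mass_fraction p 1 1 > 0" "mass_fraction p 1 2 > 0" "rod p 1 > 0"
    using assms by (auto simp: nontrivial_def)
  then show ?thesis
    unfolding mass_dist_perpendicular[OF assms] rod_offset_1 rod_offset_2
    by (auto simp: power_mult_distrib)
qed

lemma has_derivative_inverse_mass_dist: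
  fixes v :: nat and r :: real
  assumes "nontrivial p" "u \<in> {1, 2}"
  defines "s \<equiv> rod_offset p 1 u" and "t \<equiv> rod_offset p 2 v"
  defines "d \<equiv> mass_dist p u v (r, pi / 2, 0)"
  shows "((\<lambda>q. k / mass_dist p u v q) has_derivative
    (\<lambda>(x, y, z). - (k / d ^ 3) * ((r + t) * x + s * (r + t) * y - s * t * z))) (at (r, pi / 2, 0))"
proof -
  have d: "d > 0"
    unfolding d_def by (rule mass_dist_perpendicular_pos) fact+
  have d_eq: "d = sqrt ((- t - r)\<^sup>2 + s\<^sup>2)"
    unfolding d_def s_def t_def mass_dist_perpendicular[OF assms(1)]
    by (simp add: power2_eq_square algebra_simps)
  have pos: "(- t - r)\<^sup>2 + s\<^sup>2 > 0"
    using d by (simp add: d_eq)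
  let ?f = "\<lambda>q::real \<times> real \<times> real. (s * cos (fst (snd q)) - t * cos (snd (snd q)) - fst q)\<^sup>2 +
      (s * sin (fst (snd q)) - t * sin (snd (snd q)))\<^sup>2"
  have f: "(?f has_derivative
      (\<lambda>(x, y, z). 2 * ((r + t) * x + s * (r + t) * y - s * t * z))) (at (r, pi / 2, 0))"
    by (auto intro!: derivative_eq_intros simp: fun_eq_iff algebra_simps)
  \<comment> \<open>Chain rule through the squared distance \<open>?f\<close>: the 1/2 from the
    square root cancels the 2 in the derivative of \<open>?f\<close>.\<close>
  have "((\<lambda>x. k / sqrt x) has_field_derivative - k / (2 * sqrt x ^ 3)) (at x)" if "x > 0" for x
    using that by (auto intro!: derivative_eq_intros simp: divide_simps power3_eq_cube)
  from this[OF pos]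
  have "((\<lambda>x. k / sqrt x) has_field_derivative - k / (2 * d ^ 3)) (at (?f (r, pi / 2, 0)))"
    by (simp flip: d_eq)
  from has_derivative_compose[OF f this[unfolded has_field_derivative_def]]
  have "((\<lambda>q. k / sqrt (?f q)) has_derivative
    (\<lambda>(x, y, z). - (k / d ^ 3) * ((r + t) * x + s * (r + t) * y - s * t * z))) (at (r, pi / 2, 0))"
    by (rule has_derivative_eq_rhs) (auto simp: fun_eq_iff
        simp del: distrib_left_numeral right_diff_distrib_numeral)
  moreover have "(\<lambda>q. k / sqrt (?f q)) = (\<lambda>q. k / mass_dist p u v q)"
    by (auto simp: mass_dist_eq[OF assms(1)] s_def t_def)
  ultimately show ?thesis
    by simp
qed

text \<open>The factor in front of the separation vector in the scaled Newtonian force between the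
  two masses, hence the cube.\<close>

definition force_weight :: "two_dumbbells \<Rightarrow> real \<Rightarrow> nat \<Rightarrow> nat \<Rightarrow> real" where
  "force_weight p r u v =
    mass_fraction p 1 u * mass_fraction p 2 v / mass_dist p u v (r, pi / 2, 0) ^ 3"

lemma inertia_nonneg:
  assumes "nontrivial p" "i \<in> {1, 2}"
  shows "inertia p i \<ge> 0"
  using assms by (auto simp: inertia_def nontrivial_def
      intro!: mult_nonneg_nonneg divide_nonneg_nonneg less_imp_le)

lemma has_derivative_amended_potential:
  assumes "nontrivial p" "r > 0"
  defines "s \<equiv> rod_offset p 1" and "t \<equiv> rod_offset p 2" and "w \<equiv> force_weight p r"
  shows "(amended_potential p L2 has_derivative
    (\<lambda>(x, y, z).
      ((\<Sum>u\<in>{1, 2}. \<Sum>v\<in>{1, 2}. w u v * (r + t v)) -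
        L2 * r / (r\<^sup>2 + inertia p 1 + inertia p 2)\<^sup>2) * x +
      (\<Sum>u\<in>{1, 2}. \<Sum>v\<in>{1, 2}. w u v * s u * (r + t v)) * y -
      (\<Sum>u\<in>{1, 2}. \<Sum>v\<in>{1, 2}. w u v * s u * t v) * z)) (at (r, pi / 2, 0))"
proof -
  let ?B = "inertia p 1 + inertia p 2"
  have "inertia p 1 \<ge> 0" "inertia p 2 \<ge> 0"
    using assms(1) by (simp_all add: inertia_nonneg del: One_nat_def)
  then have pos: "r\<^sup>2 + ?B > 0"
    using assms(2) by (simp add: add_pos_nonneg)
  \<comment> \<open>The centrifugal term depends on the radius only: it is differentiated in one
    variable and then composed with \<open>fst\<close>.\<close>
  have "((\<lambda>x. L2 / (2 * (x\<^sup>2 + ?B))) has_field_derivative - (L2 * r / (r\<^sup>2 + ?B)\<^sup>2))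
      (at (fst (r, pi / 2, 0 :: real)))"
    using pos by (auto intro!: derivative_eq_intros simp: divide_simps)
      (simp add: algebra_simps power2_eq_square)
  then have c: "((\<lambda>q. L2 / (2 * ((fst q)\<^sup>2 + ?B))) has_derivative
      (\<lambda>h. - (L2 * r / (r\<^sup>2 + ?B)\<^sup>2) * fst h)) (at (r, pi / 2, 0 :: real))"
    unfolding has_field_derivative_def
    by (rule has_derivative_compose[rotated]) (intro derivative_intros)
  let ?k = "\<lambda>u v. mass_fraction p 1 u * mass_fraction p 2 v"
  have "(amended_potential p L2 has_derivative
      (\<lambda>h. - (L2 * r / (r\<^sup>2 + ?B)\<^sup>2) * fst h - (\<Sum>u\<in>{1, 2}. \<Sum>v\<in>{1, 2}.
        (\<lambda>(x, y, z). - w u v * ((r + t v) * x + s u * (r + t v) * y - s u * t v * z)) h))) (at (r, pi / 2, 0))"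
    (is "(_ has_derivative ?D) _")
  proof -
    have "amended_potential p L2 = (\<lambda>q. L2 / (2 * ((fst q)\<^sup>2 + ?B)) -
        (\<Sum>u\<in>{1, 2}. \<Sum>v\<in>{1, 2}. ?k u v / mass_dist p u v q))"
      by (auto simp: amended_potential_def add.assoc)
    then show ?thesis
      unfolding s_def t_def w_def force_weight_def
      by (simp only:) (intro has_derivative_diff c has_derivative_sum
          has_derivative_inverse_mass_dist assms(1))
  qed
  moreover have "?D = (\<lambda>(x, y, z).
      ((\<Sum>u\<in>{1, 2}. \<Sum>v\<in>{1, 2}. w u v * (r + t v)) -
        L2 * r / (r\<^sup>2 + inertia p 1 + inertia p 2)\<^sup>2) * x +
      (\<Sum>u\<in>{1, 2}. \<Sum>v\<in>{1, 2}. w u v * s u * (r + t v)) * y -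
      (\<Sum>u\<in>{1, 2}. \<Sum>v\<in>{1, 2}. w u v * s u * t v) * z)"
    by (auto simp: fun_eq_iff algebra_simps)
  ultimately show ?thesis
    by simp
qed

lemma linear_functional_3_eq_0_iff:
  fixes a b c :: real
  shows "(\<lambda>(x, y, z). a * x + b * y - c * z) = (\<lambda>_. 0) \<longleftrightarrow> a = 0 \<and> b = 0 \<and> c = 0"
proof
  assume *: "(\<lambda>(x, y, z). a * x + b * y - c * z) = (\<lambda>_. 0)"
  show "a = 0 \<and> b = 0 \<and> c = 0"
    using fun_cong[OF *, of "(1, 0, 0)"] fun_cong[OF *, of "(0, 1, 0)"] fun_cong[OF *, of "(0, 0, 1)"]
    by simp
qed auto

text \<open>By uniqueness of the derivative, a critical point means that three coefficients vanish.
  \<open>L2\<close> enters only the radial one, so quantifying over it leaves the two angular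
  conditions.\<close>

lemma relative_equilibrium_perpendicular_iff:
  assumes "nontrivial p" "r > 0"
  shows "(\<exists>L2. relative_equilibrium p L2 (r, pi / 2, 0)) \<longleftrightarrow>
    (\<Sum>u\<in>{1, 2}. \<Sum>v\<in>{1, 2}. force_weight p r u v * rod_offset p 1 u * (r + rod_offset p 2 v)) = 0 \<and>
    (\<Sum>u\<in>{1, 2}. \<Sum>v\<in>{1, 2}. force_weight p r u v * rod_offset p 1 u * rod_offset p 2 v) = 0"
    (is "_ \<longleftrightarrow> ?A = 0 \<and> ?C = 0")
proof -
  let ?R = "\<Sum>u\<in>{1, 2}. \<Sum>v\<in>{1, 2}. force_weight p r u v * (r + rod_offset p 2 v)"
  let ?I = "r\<^sup>2 + inertia p 1 + inertia p 2"
  have "inertia p 1 \<ge> 0" "inertia p 2 \<ge> 0"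
    using assms(1) by (simp_all add: inertia_nonneg del: One_nat_def)
  then have pos: "?I > 0"
    using assms(2) by (simp add: add_pos_nonneg)
  have "relative_equilibrium p L2 (r, pi / 2, 0) \<longleftrightarrow> ?R - L2 * r / ?I\<^sup>2 = 0 \<and> ?A = 0 \<and> ?C = 0" for L2
  proof -
    note D = has_derivative_amended_potential[OF assms, of L2]
    have "relative_equilibrium p L2 (r, pi / 2, 0) \<longleftrightarrow>
        (\<lambda>(x, y, z). (?R - L2 * r / ?I\<^sup>2) * x + ?A * y - ?C * z) = (\<lambda>_. 0)"
      (is "_ \<longleftrightarrow> ?D = _")
    proof
      assume "relative_equilibrium p L2 (r, pi / 2, 0)"
      then show "?D = (\<lambda>_. 0)"
        unfolding relative_equilibrium_def by (intro has_derivative_unique[OF D]) (rule conjunct2)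
    next
      assume "?D = (\<lambda>_. 0)"
      then show "relative_equilibrium p L2 (r, pi / 2, 0)"
        using D assms(2) by (simp only: relative_equilibrium_def fst_conv)
    qed
    then show ?thesis
      by (simp only: linear_functional_3_eq_0_iff)
  qed
  moreover have "\<exists>L2. ?R - L2 * r / ?I\<^sup>2 = 0"
    \<comment> \<open>The witness is the radial equation solved for \<open>L2\<close>; it may have
      either sign.\<close>
    using pos assms(2) by (intro exI[of _ "?R * ?I\<^sup>2 / r"]) simp
  ultimately show ?thesis
    by blast
qed

lemma angular_conditions_iff:
  assumes "nontrivial p" "r > 0"
  shows "(\<Sum>u\<in>{1, 2}. \<Sum>v\<in>{1, 2}. force_weight p r u v * rod_offset p 1 u * (r + rod_offset p 2 v)) = 0 \<and>
    (\<Sum>u\<in>{1, 2}. \<Sum>v\<in>{1, 2}. force_weight p r u v * rod_offset p 1 u * rod_offset p 2 v) = 0 \<longleftrightarrow>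
    mass_fraction p 1 1 = mass_fraction p 1 2"
    (is "?A = 0 \<and> ?C = 0 \<longleftrightarrow> _")
proof -
  define d where "d u v = mass_dist p u v (r, pi / 2, 0)" for u v
  define D where "D v = 1 / d 1 v ^ 3 - 1 / d 2 v ^ 3" for v
  let ?x1 = "mass_fraction p 1 1" and ?x2 = "mass_fraction p 1 2"
  let ?y1 = "mass_fraction p 2 1" and ?y2 = "mass_fraction p 2 2"
  let ?a = "?x1 * ?x2 * rod p 1" and ?b = "?y1 * ?y2 * rod p 2"
  have pos: "?a > 0" "?b > 0"
    using assms(1) by (auto simp: nontrivial_def)
  have y: "?y1 + ?y2 = 1"
    using assms(1) by (simp add: nontrivial_def)
  \<comment> \<open>Here \<open>?a\<close> and \<open>?b\<close> are the common absolute values of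
    mass fraction times offset on rod 1 and rod 2.\<close>
  have C: "?C = ?a * ?b * (D 1 - D 2)"
    by (simp add: force_weight_def rod_offset_1[simplified] rod_offset_2 D_def flip: d_def)
      (simp add: algebra_simps add_divide_distrib diff_divide_distrib)
  have "?A = - ?a * (?y1 * (r - ?y2 * rod p 2) * D 1 + ?y2 * (r + ?y1 * rod p 2) * D 2)"
    by (simp add: force_weight_def rod_offset_1[simplified] rod_offset_2 D_def flip: d_def)
      (simp add: algebra_simps add_divide_distrib diff_divide_distrib)
  \<comment> \<open>Substituting D_2 = D_1 - (D_1 - D_2) isolates r D_1 from a multiple of the
    factor D_1 - D_2 of \<open>?C\<close>.\<close>
  also have "\<dots> = - ?a * (r * (?y1 + ?y2) * D 1 - (?y2 * r + ?b) * (D 1 - D 2))"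
    by (simp add: algebra_simps)
  finally have A: "?A = - ?a * (r * D 1 - (?y2 * r + ?b) * (D 1 - D 2))"
    by (simp only: y mult_1_right)
  have "?A = 0 \<and> ?C = 0 \<longleftrightarrow> D 1 = 0 \<and> D 2 = 0"
    unfolding A C using pos assms(2) by auto
  moreover have "D v = 0 \<longleftrightarrow> ?x1 = ?x2" for v
  proof -
    have "d 1 v > 0" "d 2 v > 0"
      unfolding d_def by (simp_all add: mass_dist_perpendicular_pos[OF assms(1)])
    \<comment> \<open>Cubing is injective on positive distances.\<close>
    then have "D v = 0 \<longleftrightarrow> d 1 v = d 2 v"
      by (auto simp: D_def field_simps power_eq_iff_eq_base)
    then show ?thesis
      unfolding d_def by (simp only: mass_dist_perpendicular_eq_iff[OF assms(1)])
  qed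
  ultimately show ?thesis
    by (simp only: simp_thms)
qed

lemma isosceles_family_iff:
  "(p, r) \<in> isosceles_family \<longleftrightarrow>
    nontrivial p \<and> r > 0 \<and> mass_fraction p 1 1 = mass_fraction p 1 2"
  unfolding isosceles_family_def using mass_dist_perpendicular_eq_iff[of p] by blast

text \<open>The criterion does not restrict r beyond positivity: each nontrivial system with equal
  masses on dumbbell 1 contributes every r > 0.\<close>

lemma perpendicular_equilibria_iff:
  "(p, r) \<in> perpendicular_equilibria \<longleftrightarrow>
    nontrivial p \<and> r > 0 \<and> mass_fraction p 1 1 = mass_fraction p 1 2"
proof -
  have "(p, r) \<in> perpendicular_equilibria \<longleftrightarrow>
      nontrivial p \<and> r > 0 \<and> (\<exists>L2. relative_equilibrium p L2 (r, pi / 2, 0))"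
    by (auto simp: perpendicular_equilibria_def relative_equilibrium_def)
  then show ?thesis
    using relative_equilibrium_perpendicular_iff angular_conditions_iff by blast
qed

theorem theorem5p3p3:
  shows "perpendicular_equilibria = isosceles_family \<and>
    isosceles_family \<noteq> {} \<and>
    (\<forall>p r. nontrivial p \<and> r > 0 \<longrightarrow>
      ((p, r) \<in> isosceles_family \<longleftrightarrow> mass_fraction p 1 1 = mass_fraction p 1 2))"
proof (intro conjI)
  show "perpendicular_equilibria = isosceles_family"
    by (auto simp: perpendicular_equilibria_iff isosceles_family_iff simp del: One_nat_def)
  \<comment> \<open>Halving everything meets all the normalizations and makes the masses on each rod
    equal; any positive radius would serve.\<close>
  have "(\<lparr>mass = \<lambda>_. 1/2, mass_fraction = \<lambda>_ _. 1/2, rod = \<lambda>_. 1/2\<rparr>, 1) \<in> isosceles_family"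
    by (simp add: isosceles_family_iff nontrivial_def)
  then show "isosceles_family \<noteq> {}"
    by blast
qed (simp add: isosceles_family_iff)

end
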